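(* Let $z_0\in\mathbb N$, let $(X_n',Y_n')_{n\in\mathbb Z_+}$ be the leaky simple harmonic urn started at $(X_0',Y_0')=(z_0,1)$, and let $\tau=\inf\{n\in\mathbb Z_+: |X_n'|+|Y_n'|=1\}$. Then $\mathbb P(\tau<\infty)=1$. Moreover, for any $\varepsilon>0$, $\mathbb E[\tau^{1-\varepsilon}]<\infty$ but $\mathbb E[\tau^{1+\varepsilon}]=\infty$.
   Context: $\mathbb Z_+=\{0,1,2,\dots\}$, $\mathbb N=\{1,2,\dots\}$, and $\operatorname{sgn}(x)=-1,0,1$ according as $x<0$, $x=0$, $x>0$. The leaky simple harmonic urn is the Markov chain $(X_n',Y_n')_{n\in\mathbb Z_+}$ on $\mathbb Z^2\setminus\{(0,0)\}$ with the following transition law. Given $(X_n',Y_n')=(x,y)$ with $xy\ne0$, $$(X'_{n+1},Y'_{n+1})=\begin{cases}(x,y+\operatorname{sgn}(x)) & \text{with probability } \frac{|x|}{|x|+|y|},\\ (x-\operatorname{sgn}(y),y) & \text{with probability } \frac{|y|}{|x|+|y|};\end{cases}$$ if $x=0$, then $(X'_{n+1},Y'_{n+1})=(-\operatorname{sgn}(y),\,y-\operatorname{sgn}(y))$; if $y=0$, then $(X'_{n+1},Y'_{n+1})=(x-\operatorname{sgn}(x),\,\operatorname{sgn}(x))$. *)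

theory Defs
  imports "HOL-Probability.Probability"
begin

text \<open>A discrete-time process \<open>Z\<close> on \<open>M\<close> is a Markov chain with discrete
  state space \<open>S\<close> and transition law \<open>K\<close>; the values of \<open>K\<close> outside \<open>S\<close> are irrelevant.\<close>

definition markov_chain_on ::
  "'a measure \<Rightarrow> 's set \<Rightarrow> ('s \<Rightarrow> 's pmf) \<Rightarrow> (nat \<Rightarrow> 'a \<Rightarrow> 's) \<Rightarrow> bool" where
  "markov_chain_on M S K Z \<longleftrightarrow>
     prob_space M \<and>
     (\<forall>n. Z n \<in> measurable M (count_space S)) \<and>
     (\<forall>n s. \<P>(\<omega> in M. \<forall>k\<le>n. Z k \<omega> = s k) > 0 \<longrightarrow>
        \<P>(\<omega> in M. Z (Suc n) \<omega> = s (Suc n) \<bar> \<forall>k\<le>n. Z k \<omega> = s k) = pmf (K (s n)) (s (Suc n)))"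

text \<open>The value at the origin, which is not a state of the urn, is a dummy.\<close>

definition leaky_urn_step :: "int \<times> int \<Rightarrow> (int \<times> int) pmf" where
  "leaky_urn_step = (\<lambda>(x, y).
     if x = 0 then return_pmf (- sgn y, y - sgn y)
     else if y = 0 then return_pmf (x - sgn x, sgn x)
     else map_pmf (\<lambda>b. if b then (x, y + sgn x) else (x - sgn y, y))
            (bernoulli_pmf (real_of_int \<bar>x\<bar> / real_of_int (\<bar>x\<bar> + \<bar>y\<bar>))))"

definition leaky_urn :: "'a measure \<Rightarrow> (nat \<Rightarrow> 'a \<Rightarrow> int \<times> int) \<Rightarrow> bool" where
  "leaky_urn M Z \<longleftrightarrow> markov_chain_on M (UNIV - {(0, 0)}) leaky_urn_step Z"

text \<open>The infimum is taken in \<^typ>\<open>enat\<close>, so it is \<open>\<infinity>\<close> if the level is never reached.\<close>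

definition urn_tau :: "(nat \<Rightarrow> 'a \<Rightarrow> int \<times> int) \<Rightarrow> 'a \<Rightarrow> enat" where
  "urn_tau Z \<omega> = Inf (enat ` {n. \<bar>fst (Z n \<omega>)\<bar> + \<bar>snd (Z n \<omega>)\<bar> = 1})"

text \<open>Real powers of extended naturals, with the usual conventions \<open>t\<^sup>0 = 1\<close>,
  \<open>0\<^sup>p = 0\<close> and \<open>\<infinity>\<^sup>p = \<infinity>\<close> for \<open>p > 0\<close>, and \<open>0\<^sup>p = \<infinity>\<close> and \<open>\<infinity>\<^sup>p = 0\<close> for \<open>p < 0\<close>.
  (Note that \<open>0 powr 0 = 0\<close> and \<open>0 powr p = 0\<close> for negative \<open>p\<close> in the library.)\<close>

definition enat_powr :: "enat \<Rightarrow> real \<Rightarrow> ennreal" where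
  "enat_powr t p =
     (if p = 0 then 1
      else case t of
        enat n \<Rightarrow> if n = 0 \<and> p < 0 then \<infinity> else ennreal (real n powr p)
      | \<infinity> \<Rightarrow> if p < 0 then 0 else \<infinity>)"

end

theory Submission
  imports Defs
begin

text \<open>
  Rotating by multiples of a right angle, the urn becomes a chain on \<open>{(u, v). u \<ge> 0 \<and> v \<ge> 1}\<close>
  with target \<open>(0, 1)\<close>. For it \<open>W = u (u + 1) + v (v - 1)\<close> is an exact martingale, also across
  the axis, and vanishes only at the target. With \<open>\<psi> = 2/3 u v (u - v + 2)\<close>, the
  drift of \<open>W\<^sup>2 / 2 + \<psi>\<close> is exactly \<open>2/3 W\<close>.

  Lower bound: \<open>W\<close> has constant mean and its second moment grows at most linearly, so the
  second moment method gives \<open>P(\<tau> > n) \<ge> c / n\<close>; hence already \<open>E \<tau> = \<infinity>\<close>.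

  Upper bound: for large \<open>A\<close> the function \<open>(W + A) ln (W + A) + \<psi> / (W + A)\<close> has drift bounded below
  by a positive constant until absorption. Since \<open>u + v\<close> grows by at most one per step, its mean at
  time \<open>n\<close> is at most \<open>E (W + A) \<cdot> O(log n) = O(log n)\<close>. So the sum of \<open>P(\<tau> > k)\<close> over \<open>k < n\<close> is
  \<open>O(log n)\<close>, and by monotonicity \<open>P(\<tau> > n) = O(log n / n)\<close>.
\<close>

section \<open>The energy and its Lyapunov function\<close>

text \<open>The right side is the cubic Taylor polynomial at 0. The difference \<open>g\<close> of
  the two sides has derivative \<open>h\<close>, which vanishes at 0 and is nondecreasing, its own
  derivative being \<open>s^2 / (1 + s)\<close>; so \<open>g\<close> is minimal at 0.\<close>

lemma xlnx_taylor_unit: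
  fixes t :: real
  assumes "t > -1"
  shows "(1 + t) * ln (1 + t) \<ge> t + t\<^sup>2 / 2 - t ^ 3 / 6"
proof -
  define h where "h = (\<lambda>t::real. ln (1 + t) - t + t\<^sup>2 / 2)"
  define g where "g = (\<lambda>t::real. (1 + t) * ln (1 + t) - t - t\<^sup>2 / 2 + t ^ 3 / 6)"
  have h': "(h has_real_derivative (s\<^sup>2 / (1 + s))) (at s)" if "s > -1" for s
    unfolding h_def using that
    by (auto intro!: derivative_eq_intros simp: field_simps power2_eq_square)
  have g': "(g has_real_derivative h s) (at s)" if "s > -1" for s
  proof -
    have "(g has_real_derivative (1 * ln (1 + s) + (1 + s) * (1 / (1 + s)) - 1 - 2 * s / 2 + 3 * s\<^sup>2 / 6)) (at s)"
      unfolding g_def using that by (auto intro!: derivative_eq_intros)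
    then show ?thesis using that by (simp add: h_def)
  qed
  have h_mono: "h a \<le> h b" if "-1 < a" "a \<le> b" for a b
  proof (rule DERIV_nonneg_imp_nondecreasing[OF that(2)])
    fix s assume "a \<le> s" "s \<le> b"
    then show "\<exists>y. (h has_real_derivative y) (at s) \<and> y \<ge> 0"
      using that h'[of s] by (intro exI[of _ "s\<^sup>2 / (1 + s)"]) auto
  qed
  have h0: "h 0 = 0" by (simp add: h_def)
  have "g t \<ge> g 0"
  proof (cases "t \<ge> 0")
    case True
    show ?thesis
    proof (rule DERIV_nonneg_imp_nondecreasing[OF True])
      fix s assume "0 \<le> s" "s \<le> t"
      then show "\<exists>y. (g has_real_derivative y) (at s) \<and> y \<ge> 0"
        using g'[of s] h_mono[of 0 s] h0 by (intro exI[of _ "h s"]) auto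
    qed
  next
    case False
    then have "t \<le> 0" by simp
    then show ?thesis
    proof (rule DERIV_nonpos_imp_nonincreasing)
      fix s assume "t \<le> s" "s \<le> 0"
      then show "\<exists>y. (g has_real_derivative y) (at s) \<and> y \<le> 0"
        using assms g'[of s] h_mono[of s 0] h0 by (intro exI[of _ "h s"]) auto
    qed
  qed
  then show ?thesis by (simp add: g_def)
qed

lemma xlnx_taylor:
  fixes x d :: real
  assumes "x > 0" "x + d > 0"
  shows "(x + d) * ln (x + d) \<ge> x * ln x + (1 + ln x) * d + d\<^sup>2 / (2 * x) - d ^ 3 / (6 * x\<^sup>2)"
proof -
  define t where "t = d / x"
  have d: "d = x * t" using assms by (simp add: t_def)
  have t: "1 + t > 0" using assms by (simp add: t_def field_simps)
  have "ln (x + d) = ln x + ln (1 + t)"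
    using assms t by (simp add: d ln_mult flip: distrib_left[of x 1 t, simplified])
  then have "(x + d) * ln (x + d) = x * ln x + x * t * ln x + x * ((1 + t) * ln (1 + t))"
    by (simp add: d algebra_simps)
  also have "\<dots> \<ge> x * ln x + x * t * ln x + x * (t + t\<^sup>2 / 2 - t ^ 3 / 6)"
    using xlnx_taylor_unit[of t] t assms by (intro add_left_mono mult_left_mono) auto
  also have "x * ln x + x * t * ln x + x * (t + t\<^sup>2 / 2 - t ^ 3 / 6) =
     x * ln x + (1 + ln x) * d + d\<^sup>2 / (2 * x) - d ^ 3 / (6 * x\<^sup>2)"
    using assms by (simp add: d field_simps power2_eq_square power3_eq_cube)
  finally show ?thesis .
qed

text \<open>In the application \<open>m = u + v\<close>, \<open>x\<close> is the shifted energy and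
  \<open>d\<close> its increment. The discarded terms \<open>d^3 / 6\<close>,
  \<open>d (\<psi>' - \<psi>)\<close> and \<open>d^2 \<psi>' / (x + d)\<close> are all of order
  \<open>m^3\<close>, with constants 2, 4 and 16. The coefficient of \<open>d\<close> does not
  depend on the step taken, so it can cancel on averaging.\<close>

lemma corrected_xlnx_increment:
  fixes x d m \<psi> \<psi>' :: real
  assumes x: "x > 0" "x + d > 0" "x + d \<ge> m\<^sup>2 / 4" and m: "m > 0"
    and d: "\<bar>d\<bar> \<le> 2 * m" and \<psi>': "\<bar>\<psi>'\<bar> \<le> m ^ 3" and \<psi>: "\<bar>\<psi>' - \<psi>\<bar> \<le> 2 * m\<^sup>2"
  shows "(x + d) * ln (x + d) + \<psi>' / (x + d) \<ge> x * ln x + \<psi> / x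
    + (1 + ln x - \<psi> / x\<^sup>2) * d + (d\<^sup>2 / 2 + \<psi>' - \<psi>) / x - 22 * m ^ 3 / x\<^sup>2"
proof -
  have d2: "d\<^sup>2 \<le> (2 * m)\<^sup>2" using d by (metis abs_le_square_iff abs_of_pos m mult_pos_pos zero_less_numeral)
  have "d\<^sup>2 * \<bar>\<psi>'\<bar> \<le> (4 * m\<^sup>2) * m ^ 3"
    using d2 \<psi>' by (intro mult_mono) auto
  also have "\<dots> = (m\<^sup>2 / 4) * (16 * m ^ 3)" by simp
  also have "\<dots> \<le> (x + d) * (16 * m ^ 3)" using x m by (intro mult_right_mono) auto
  finally have "d\<^sup>2 * \<bar>\<psi>'\<bar> / (x + d) \<le> 16 * m ^ 3"
    using x by (simp add: field_simps)
  moreover have "- (d\<^sup>2 * \<psi>' / (x + d)) \<le> d\<^sup>2 * \<bar>\<psi>'\<bar> / (x + d)"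
  proof -
    have "d\<^sup>2 * (- \<psi>') \<le> d\<^sup>2 * \<bar>\<psi>'\<bar>" by (intro mult_left_mono) auto
    then have "d\<^sup>2 * (- \<psi>') / (x + d) \<le> d\<^sup>2 * \<bar>\<psi>'\<bar> / (x + d)"
      using x by (intro divide_right_mono) auto
    then show ?thesis by simp
  qed
  ultimately have e1: "- (d\<^sup>2 * \<psi>' / (x + d)) \<le> 16 * m ^ 3" by (rule order_trans[rotated])
  have "\<bar>d * (\<psi>' - \<psi>)\<bar> \<le> (2 * m) * (2 * m\<^sup>2)"
    unfolding abs_mult using d \<psi> m by (intro mult_mono) auto
  then have e2: "d * (\<psi>' - \<psi>) \<le> 4 * m ^ 3"
    by (simp add: power2_eq_square power3_eq_cube)
  have "\<bar>d ^ 3\<bar> \<le> (2 * m) ^ 3"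
    unfolding power_abs using d by (intro power_mono) auto
  then have e3: "d ^ 3 / 6 \<le> 2 * m ^ 3" using m by (simp add: power_mult_distrib)
  have "d ^ 3 / 6 + d * (\<psi>' - \<psi>) - d\<^sup>2 * \<psi>' / (x + d) \<le> 22 * m ^ 3"
    using e1 e2 e3 by linarith
  then have err: "(d ^ 3 / 6 + d * (\<psi>' - \<psi>) - d\<^sup>2 * \<psi>' / (x + d)) / x\<^sup>2 \<le> 22 * m ^ 3 / x\<^sup>2"
    by (intro divide_right_mono) auto
  \<comment> \<open>Exact second-order expansion of \<open>1 / (x + d)\<close>; its remainder keeps
    the denominator \<open>x + d\<close>, whence the assumed lower bound
    \<open>m^2 / 4\<close>.\<close>
  have inv: "\<psi>' / (x + d) = \<psi>' / x - d * \<psi>' / x\<^sup>2 + (d\<^sup>2 * \<psi>' / (x + d)) / x\<^sup>2"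
  proof -
    define y where "y = x + d"
    have y: "y > 0" and d_eq: "d = y - x" using x by (auto simp: y_def)
    show ?thesis
      unfolding y_def[symmetric] unfolding d_eq using x(1) y by (simp add: field_simps power2_eq_square)
  qed
  have "x * ln x + (1 + ln x) * d + d\<^sup>2 / (2 * x) - d ^ 3 / (6 * x\<^sup>2) + \<psi>' / (x + d)
     = x * ln x + \<psi> / x + (1 + ln x - \<psi> / x\<^sup>2) * d + (d\<^sup>2 / 2 + \<psi>' - \<psi>) / x
       - (d ^ 3 / 6 + d * (\<psi>' - \<psi>) - d\<^sup>2 * \<psi>' / (x + d)) / x\<^sup>2"
    unfolding inv by (simp add: algebra_simps add_divide_distrib diff_divide_distrib)
  moreover have "c - E \<le> L + b" if "a + b = c - e" "a \<le> L" "e \<le> E" for a b c e E L :: real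
    using that by linarith
  ultimately show ?thesis using xlnx_taylor[OF x(1,2)] err by blast
qed

text \<open>This is the squared distance from \<open>(-1/2, 1/2)\<close>, minus 1/2. Off the axis
  \<open>u^2 + v^2\<close> has drift 1, and \<open>u - v\<close> drops by exactly 1 at every step,
  so the two compensate.\<close>

definition energy :: "real \<Rightarrow> real \<Rightarrow> real" where
  "energy u v = u * (u + 1) + v * (v - 1)"

text \<open>
  Solves the Poisson equation that replaces the local variance \<open>4 u v\<close> of the energy, which
  degenerates near the axes, by its rotational average \<open>4/3 W\<close>.
\<close>

definition corrector :: "real \<Rightarrow> real \<Rightarrow> real" where
  "corrector u v = 2 / 3 * u * v * (u - v + 2)"

text \<open>The shift 30000 makes the third-order Taylor errors at most half of the main term at every state.\<close>

definition lyapunov :: "real \<Rightarrow> real \<Rightarrow> real" where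
  "lyapunov u v = (energy u v + 30000) * ln (energy u v + 30000) + corrector u v / (energy u v + 30000)"

lemma energy_ge_square:
  assumes "u \<ge> 1" "v \<ge> 1"
  shows "(u + v)\<^sup>2 \<le> 3 * energy u v"
proof -
  \<comment> \<open>The sum is exactly the right side of the claim minus the left side.\<close>
  have "0 \<le> (u - v)\<^sup>2 + (u - 1) * (u + 4) + (v - 3/2)\<^sup>2 + 7/4"
    using assms by (intro add_nonneg_nonneg mult_nonneg_nonneg) auto
  then show ?thesis by (simp add: energy_def power2_eq_square algebra_simps)
qed

lemma energy_le_square:
  assumes "u \<ge> 0" "v \<ge> 1"
  shows "energy u v \<le> (u + v)\<^sup>2"
proof -
  have "0 \<le> u * (v - 1) + u * v + v" using assms by (intro add_nonneg_nonneg mult_nonneg_nonneg) auto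
  then show ?thesis by (simp add: energy_def power2_eq_square algebra_simps)
qed

text \<open>The factor 3/2 makes room for neighbouring states: for \<open>m \<ge> 2\<close> it
  admits coordinate sums up to \<open>m + 1\<close>.\<close>

lemma abs_corrector_le:
  assumes "u \<ge> 0" "v \<ge> 0" "u + v \<le> 3 / 2 * m" "m \<ge> 2"
  shows "\<bar>corrector u v\<bar> \<le> m ^ 3"
proof -
  have "4 * (u * v) \<le> (u + v)\<^sup>2"
    using zero_le_power2[of "u - v"] by (simp add: power2_eq_square algebra_simps)
  also have "\<dots> \<le> (3 / 2 * m)\<^sup>2" using assms by (intro power_mono) auto
  finally have uv: "u * v \<le> 9 / 16 * m\<^sup>2" by (simp add: power2_eq_square)
  have "\<bar>corrector u v\<bar> = 2 / 3 * (u * v) * \<bar>u - v + 2\<bar>"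
    using assms by (simp add: corrector_def abs_mult)
  also have "\<dots> \<le> 2 / 3 * (9 / 16 * m\<^sup>2) * (5 / 2 * m)"
  proof (rule mult_mono)
    show "\<bar>u - v + 2\<bar> \<le> 5 / 2 * m" using assms by linarith
  qed (use uv assms in auto)
  also have "\<dots> = 15 / 16 * m ^ 3" by (simp add: power2_eq_square power3_eq_cube)
  also have "\<dots> \<le> m ^ 3" using assms by simp
  finally show ?thesis .
qed

lemma lyapunov_drift:
  assumes u: "u \<ge> 1" and v: "v \<ge> 1"
  shows "u / (u + v) * lyapunov u (v + 1) + v / (u + v) * lyapunov (u - 1) v
    \<ge> lyapunov u v + energy u v / (3 * (energy u v + 30000))"
proof -
  define m where "m = u + v"
  define W where "W = energy u v"
  define x where "x = W + 30000"
  define \<psi> where "\<psi> = corrector u v"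
  define \<psi>1 where "\<psi>1 = corrector u (v + 1)"
  define \<psi>2 where "\<psi>2 = corrector (u - 1) v"
  have m: "m \<ge> 2" using u v by (simp add: m_def)
  have mW: "m\<^sup>2 \<le> 3 * W" using energy_ge_square[OF u v] by (simp add: m_def W_def)
  have W0: "W \<ge> 0" using mW zero_le_power2[of m] by linarith
  have x0: "x > 0" using W0 by (simp add: x_def)
  \<comment> \<open>Both possible new values of the shifted energy are at least
    \<open>x - 2 m\<close>; completing the square gives the bound \<open>m^2 / 4\<close> that the
    expansion asks for.\<close>
  have "0 \<le> (m - 12)\<^sup>2" by simp
  then have "m\<^sup>2 / 4 \<le> m\<^sup>2 / 3 - 2 * m + 30000" by (simp add: power2_eq_square algebra_simps)
  then have big: "x - 2 * m \<ge> m\<^sup>2 / 4" using mW unfolding x_def by linarith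
  have m20: "m\<^sup>2 / 4 > 0" using m by simp
  have W1: "energy u (v + 1) + 30000 = x + 2 * v"
    by (simp add: x_def W_def energy_def algebra_simps)
  have W2: "energy (u - 1) v + 30000 = x + (- 2 * u)"
    by (simp add: x_def W_def energy_def algebra_simps)
  have \<psi>1: "\<psi>1 - \<psi> = 2 / 3 * u * (u - 2 * v + 1)"
    by (simp add: \<psi>1_def \<psi>_def corrector_def field_simps)
  have \<psi>2: "\<psi>2 - \<psi> = 2 / 3 * v * (v - 2 * u - 1)"
    by (simp add: \<psi>2_def \<psi>_def corrector_def field_simps)
  have b1: "\<bar>\<psi>1 - \<psi>\<bar> \<le> 2 * m\<^sup>2"
  proof -
    have "\<bar>\<psi>1 - \<psi>\<bar> = 2 / 3 * u * \<bar>u - 2 * v + 1\<bar>" using u by (simp add: \<psi>1 abs_mult)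
    also have "\<dots> \<le> 2 / 3 * m * (3 * m)"
      using u v by (intro mult_mono) (auto simp: m_def)
    finally show ?thesis by (simp add: power2_eq_square)
  qed
  have b2: "\<bar>\<psi>2 - \<psi>\<bar> \<le> 2 * m\<^sup>2"
  proof -
    have "\<bar>\<psi>2 - \<psi>\<bar> = 2 / 3 * v * \<bar>v - 2 * u - 1\<bar>" using v by (simp add: \<psi>2 abs_mult)
    also have "\<dots> \<le> 2 / 3 * m * (3 * m)"
      using u v by (intro mult_mono) (auto simp: m_def)
    finally show ?thesis by (simp add: power2_eq_square)
  qed
  have c1: "\<bar>\<psi>1\<bar> \<le> m ^ 3" unfolding \<psi>1_def using u v m
    by (intro abs_corrector_le) (auto simp: m_def)
  have c2: "\<bar>\<psi>2\<bar> \<le> m ^ 3" unfolding \<psi>2_def using u v m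
    by (intro abs_corrector_le) (auto simp: m_def)
  define c where "c = 1 + ln x - \<psi> / x\<^sup>2"
  define B where "B = x * ln x + \<psi> / x - 22 * m ^ 3 / x\<^sup>2"
  have g1: "lyapunov u (v + 1) \<ge> B + c * (2 * v) + ((2 * v)\<^sup>2 / 2 + \<psi>1 - \<psi>) / x"
    unfolding lyapunov_def W1 B_def c_def \<psi>1_def[symmetric]
    using corrected_xlnx_increment[of x "2 * v" m \<psi>1 \<psi>] x0 big m20 m u v b1 c1
    by (auto simp: m_def)
  have g2: "lyapunov (u - 1) v \<ge> B + c * (- 2 * u) + ((- 2 * u)\<^sup>2 / 2 + \<psi>2 - \<psi>) / x"
    unfolding lyapunov_def W2 B_def c_def \<psi>2_def[symmetric]
    using corrected_xlnx_increment[of x "- 2 * u" m \<psi>2 \<psi>] x0 big m20 m u v b2 c2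
    by (auto simp: m_def)
  have "u / m * lyapunov u (v + 1) + v / m * lyapunov (u - 1) v \<ge>
     u / m * (B + c * (2 * v) + ((2 * v)\<^sup>2 / 2 + \<psi>1 - \<psi>) / x)
     + v / m * (B + c * (- 2 * u) + ((- 2 * u)\<^sup>2 / 2 + \<psi>2 - \<psi>) / x)"
    using g1 g2 u v m by (intro add_mono mult_left_mono) auto
  \<comment> \<open>The terms in \<open>c\<close> cancel because \<open>u * 2 v = v * 2 u\<close>;
    this is the martingale property of the energy.\<close>
  also have "u / m * (B + c * (2 * v) + ((2 * v)\<^sup>2 / 2 + \<psi>1 - \<psi>) / x)
     + v / m * (B + c * (- 2 * u) + ((- 2 * u)\<^sup>2 / 2 + \<psi>2 - \<psi>) / x)
     = (u + v) / m * B + (u * (2 * v\<^sup>2 + (\<psi>1 - \<psi>)) + v * (2 * u\<^sup>2 + (\<psi>2 - \<psi>))) / m / x"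
    by (simp add: add_divide_distrib diff_divide_distrib algebra_simps power2_eq_square)
  \<comment> \<open>The mean of \<open>d^2 / 2\<close> alone is \<open>2 u v\<close>, which near the
    axes is small compared with \<open>W\<close>; the drift of the corrector turns it into exactly
    \<open>2/3 W\<close>.\<close>
  also have "u * (2 * v\<^sup>2 + (\<psi>1 - \<psi>)) + v * (2 * u\<^sup>2 + (\<psi>2 - \<psi>)) = 2 / 3 * W * m"
    unfolding \<psi>1 \<psi>2 W_def energy_def m_def by (simp add: field_simps power2_eq_square)
  also have "(u + v) / m * B + 2 / 3 * W * m / m / x = B + 2 / 3 * W / x"
  proof -
    have "(u + v) / m = 1" using m by (simp add: m_def)
    moreover have "2 / 3 * W * m / m = 2 / 3 * W" using m by simp
    ultimately show ?thesis by (simp only: mult_1_left)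
  qed
  finally have main: "u / m * lyapunov u (v + 1) + v / m * lyapunov (u - 1) v \<ge> B + 2 / 3 * W / x" .
  have "22 * m ^ 3 \<le> W * x / 3"
  proof -
    \<comment> \<open>The strictest demand on the shift: it needs
      \<open>297^2 \<le> 3 * 30000\<close>. Half of the drift \<open>2/3 W / x\<close> then survives
      the error.\<close>
    have "0 \<le> (m - 297)\<^sup>2" by simp
    then have "66 * m \<le> (m\<^sup>2 / 3 + 30000) / 3" by (simp add: power2_eq_square algebra_simps)
    then have "m\<^sup>2 * (66 * m) \<le> m\<^sup>2 * ((m\<^sup>2 / 3 + 30000) / 3)" by (intro mult_left_mono) auto
    also have "\<dots> \<le> (3 * W) * (x / 3)"
      using mW W0 by (intro mult_mono) (auto simp: x_def)
    finally show ?thesis by (simp add: power2_eq_square power3_eq_cube)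
  qed
  then have "22 * m ^ 3 / x\<^sup>2 \<le> W * x / 3 / x\<^sup>2" by (intro divide_right_mono) auto
  also have "\<dots> = W / (3 * x)" using x0 by (simp add: power2_eq_square)
  finally have "B + 2 / 3 * W / x \<ge> x * ln x + \<psi> / x + W / (3 * x)"
    unfolding B_def by (simp add: field_simps)
  with main have "u / m * lyapunov u (v + 1) + v / m * lyapunov (u - 1) v
      \<ge> x * ln x + \<psi> / x + W / (3 * x)" by linarith
  then show ?thesis
    unfolding lyapunov_def[of u v] W_def[symmetric] x_def[symmetric] \<psi>_def[symmetric] m_def[symmetric] .
qed

text \<open>Crossing the axis preserves the energy, while the corrector jumps from 0 to
  \<open>2/3 (v - 1) v = 2/3 W\<close>. The gain has the same form as the main term of the interior
  drift.\<close>

lemma lyapunov_axis_step: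
  "lyapunov (v - 1) 1 = lyapunov 0 v + 2 / 3 * energy 0 v / (energy 0 v + 30000)"
proof -
  have "energy (v - 1) 1 = energy 0 v" by (simp add: energy_def algebra_simps)
  moreover have "corrector (v - 1) 1 = corrector 0 v + 2 / 3 * energy 0 v"
    by (simp add: corrector_def energy_def algebra_simps)
  ultimately show ?thesis by (simp add: lyapunov_def add_divide_distrib)
qed

text \<open>The corrector is of order \<open>m^3\<close>, hence below \<open>x^2\<close>, so its
  quotient by \<open>x\<close> costs at most one further \<open>x\<close>. The alternative for
  \<open>u\<close> reflects that states are integral.\<close>

lemma lyapunov_le:
  assumes "u \<ge> 0" "v \<ge> 1" "u = 0 \<or> u \<ge> 1"
  shows "lyapunov u v \<le> (energy u v + 30000) * (ln (energy u v + 30000) + 1)"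
proof -
  define x where "x = energy u v + 30000"
  have x: "x \<ge> 30000" using assms by (auto simp: x_def energy_def)
  have "corrector u v \<le> x * x"
  proof (cases "u = 0")
    case True then show ?thesis by (simp add: corrector_def)
  next
    case False
    then have u: "u \<ge> 1" using assms by auto
    define m where "m = u + v"
    have m: "m \<ge> 2" using u assms by (simp add: m_def)
    have mW: "m\<^sup>2 \<le> 3 * energy u v" using energy_ge_square[OF u assms(2)] by (simp add: m_def)
    have "corrector u v \<le> m ^ 3" using abs_corrector_le[of u v m] assms m by (auto simp: m_def)
    also have "m ^ 3 = m\<^sup>2 * m" by (simp add: power2_eq_square power3_eq_cube)
    also have "\<dots> \<le> (3 * x) * (x / 3)"
    proof (intro mult_mono)
      show "m\<^sup>2 \<le> 3 * x" using mW by (simp add: x_def)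
      have "0 \<le> (m - 9 / 2)\<^sup>2" by simp
      then have "3 * m \<le> m\<^sup>2 / 3 + 30000" by (simp add: power2_eq_square algebra_simps)
      then show "m \<le> x / 3" using mW by (simp add: x_def)
    qed (use m x in auto)
    finally show ?thesis by simp
  qed
  then have "corrector u v / x \<le> x" using x by (simp add: field_simps)
  then show ?thesis by (simp add: lyapunov_def algebra_simps flip: x_def)
qed

section \<open>Discrete Markov chains\<close>

lemma markov_chain_on_measurable:
  assumes "markov_chain_on M S K Z"
  shows "Z n \<in> measurable M (count_space UNIV)"
proof (rule measurableI)
  have Z: "Z n \<in> measurable M (count_space S)" using assms by (simp add: markov_chain_on_def)
  fix A :: "'b set"
  have "Z n -` A \<inter> space M = Z n -` (A \<inter> S) \<inter> space M"
    using measurable_space[OF Z] by auto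
  also have "\<dots> \<in> sets M" using Z by (rule measurable_sets) auto
  finally show "Z n -` A \<inter> space M \<in> sets M" .
qed simp

text \<open>The definition conditions on complete histories. Summing over the countably many
  histories that end in \<open>a\<close> leaves a condition on the present only; null histories
  contribute 0 to both sides.\<close>

lemma markov_chain_on_joint:
  fixes Z :: "nat \<Rightarrow> 'a \<Rightarrow> 's::countable"
  assumes mc: "markov_chain_on M S K Z"
  shows "emeasure M {\<omega> \<in> space M. Z n \<omega> = a \<and> Z (Suc n) \<omega> = b}
    = emeasure M {\<omega> \<in> space M. Z n \<omega> = a} * ennreal (pmf (K a) b)"
proof -
  interpret prob_space M using mc by (simp add: markov_chain_on_def)
  note [measurable] = markov_chain_on_measurable[OF mc]
  \<comment> \<open>Extensional functions represent each history once, so the index set is countable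
    and the events are disjoint.\<close>
  define I where "I = {s \<in> PiE {..n} (\<lambda>_. UNIV :: 's set). s n = a}"
  define path where "path = (\<lambda>s. {\<omega> \<in> space M. \<forall>k\<le>n. Z k \<omega> = s k})"
  define next_path where "next_path = (\<lambda>s. {\<omega> \<in> space M. Z (Suc n) \<omega> = b \<and> (\<forall>k\<le>n. Z k \<omega> = s k)})"
  have I: "countable I"
    unfolding I_def by (rule countable_subset[OF _ countable_PiE[of "{..n}" "\<lambda>_. UNIV"]]) auto
  have meas: "path s \<in> sets M" "next_path s \<in> sets M" for s
    unfolding path_def next_path_def by measurable
  have disj: "disjoint_family_on path I" "disjoint_family_on next_path I"
    unfolding disjoint_family_on_def I_def path_def next_path_def by (auto, (metis PiE_ext atMost_iff)+)
  have path: "{\<omega> \<in> space M. Z n \<omega> = a} = \<Union> (path ` I)"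
  proof safe
    fix \<omega> assume "\<omega> \<in> space M" "a = Z n \<omega>"
    then show "\<omega> \<in> \<Union> (path ` I)"
      by (intro UN_I[of "restrict (\<lambda>k. Z k \<omega>) {..n}"]) (auto simp: I_def path_def)
  qed (auto simp: I_def path_def)
  have next_path: "{\<omega> \<in> space M. Z n \<omega> = a \<and> Z (Suc n) \<omega> = b} = \<Union> (next_path ` I)"
  proof safe
    fix \<omega> assume "\<omega> \<in> space M" "a = Z n \<omega>" "b = Z (Suc n) \<omega>"
    then show "\<omega> \<in> \<Union> (next_path ` I)"
      by (intro UN_I[of "restrict (\<lambda>k. Z k \<omega>) {..n}"]) (auto simp: I_def next_path_def)
  qed (auto simp: I_def next_path_def)
  have step: "emeasure M (next_path s) = emeasure M (path s) * ennreal (pmf (K a) b)" if "s \<in> I" for s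
  proof (cases "measure M (path s) > 0")
    case True
    \<comment> \<open>The definition reads both the past and the next value off one function, so
      \<open>b\<close> is stored at index \<open>Suc n\<close>.\<close>
    define s' where "s' = s(Suc n := b)"
    have eq: "(\<forall>k\<le>n. Z k \<omega> = s' k) \<longleftrightarrow> (\<forall>k\<le>n. Z k \<omega> = s k)" for \<omega>
      by (auto simp: s'_def)
    have "\<P>(\<omega> in M. \<forall>k\<le>n. Z k \<omega> = s' k) > 0"
      using True unfolding eq path_def .
    then have "\<P>(\<omega> in M. Z (Suc n) \<omega> = s' (Suc n) \<bar> \<forall>k\<le>n. Z k \<omega> = s' k) = pmf (K (s' n)) (s' (Suc n))"
      using mc unfolding markov_chain_on_def by blast
    then have "measure M (next_path s) / measure M (path s) = pmf (K a) b"
      using that unfolding cond_prob_def eq by (simp add: s'_def I_def path_def next_path_def)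
    then have "measure M (next_path s) = measure M (path s) * pmf (K a) b"
      using True by (simp add: field_simps)
    then show ?thesis by (simp add: emeasure_eq_measure ennreal_mult)
  next
    case False
    then have "measure M (path s) = 0" using measure_nonneg[of M "path s"] by linarith
    moreover have "measure M (next_path s) \<le> measure M (path s)"
      using meas by (intro finite_measure_mono) (auto simp: path_def next_path_def)
    ultimately show ?thesis by (simp add: emeasure_eq_measure measure_le_0_iff)
  qed
  have "emeasure M (\<Union> (next_path ` I)) = (\<integral>\<^sup>+s. emeasure M (next_path s) \<partial>count_space I)"
    using I meas disj by (intro emeasure_UN_countable) auto
  also have "\<dots> = (\<integral>\<^sup>+s. emeasure M (path s) * ennreal (pmf (K a) b) \<partial>count_space I)"
    by (intro nn_integral_cong) (simp add: step)
  also have "\<dots> = (\<integral>\<^sup>+s. emeasure M (path s) \<partial>count_space I) * ennreal (pmf (K a) b)"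
    by (intro nn_integral_multc) auto
  also have "(\<integral>\<^sup>+s. emeasure M (path s) \<partial>count_space I) = emeasure M (\<Union> (path ` I))"
    using I meas disj by (intro emeasure_UN_countable[symmetric]) auto
  finally show ?thesis unfolding path next_path .
qed

text \<open>Only countably many null events are discarded, one for each time and forbidden
  transition. Absorption will thus hold along almost every path.\<close>

lemma markov_chain_on_AE_step:
  fixes Z :: "nat \<Rightarrow> 'a \<Rightarrow> 's::countable"
  assumes mc: "markov_chain_on M S K Z"
  shows "AE \<omega> in M. \<forall>n. Z (Suc n) \<omega> \<in> set_pmf (K (Z n \<omega>))"
proof -
  note [measurable] = markov_chain_on_measurable[OF mc]
  have "AE \<omega> in M. b \<notin> set_pmf (K a) \<longrightarrow> \<not> (Z n \<omega> = a \<and> Z (Suc n) \<omega> = b)" for n a b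
  proof (cases "b \<in> set_pmf (K a)")
    case False
    then have "emeasure M {\<omega> \<in> space M. Z n \<omega> = a \<and> Z (Suc n) \<omega> = b} = 0"
      by (simp add: markov_chain_on_joint[OF mc] set_pmf_iff)
    moreover have "{\<omega> \<in> space M. Z n \<omega> = a \<and> Z (Suc n) \<omega> = b} \<in> sets M" by measurable
    ultimately have "AE \<omega> in M. \<not> (Z n \<omega> = a \<and> Z (Suc n) \<omega> = b)"
      by (intro AE_I'[of "{\<omega> \<in> space M. Z n \<omega> = a \<and> Z (Suc n) \<omega> = b}"]) auto
    then show ?thesis by eventually_elim auto
  qed auto
  then have "AE \<omega> in M. \<forall>n a b. b \<notin> set_pmf (K a) \<longrightarrow> \<not> (Z n \<omega> = a \<and> Z (Suc n) \<omega> = b)"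
    unfolding AE_all_countable by blast
  then show ?thesis by eventually_elim blast
qed

primrec chain_law :: "('s \<Rightarrow> 's pmf) \<Rightarrow> 's \<Rightarrow> nat \<Rightarrow> 's pmf" where
  "chain_law K z 0 = return_pmf z"
| "chain_law K z (Suc n) = bind_pmf (chain_law K z n) K"

lemma markov_chain_on_distr:
  fixes Z :: "nat \<Rightarrow> 'a \<Rightarrow> 's::countable"
  assumes mc: "markov_chain_on M S K Z" and init: "AE \<omega> in M. Z 0 \<omega> = z"
  shows "distr M (count_space UNIV) (Z n) = measure_pmf (chain_law K z n)"
proof -
  interpret prob_space M using mc by (simp add: markov_chain_on_def)
  note [measurable] = markov_chain_on_measurable[OF mc]
  have "emeasure M {\<omega> \<in> space M. Z n \<omega> = a} = ennreal (pmf (chain_law K z n) a)" for a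
  proof (induction n arbitrary: a)
    case 0
    have "emeasure M {\<omega> \<in> space M. Z 0 \<omega> = a} = emeasure M {\<omega> \<in> space M. z = a}"
      using init by (intro emeasure_Collect_eq_AE) (auto elim!: eventually_mono)
    then show ?case by (simp add: emeasure_space_1 pmf_return indicator_def)
  next
    case (Suc n)
    have "{\<omega> \<in> space M. Z (Suc n) \<omega> = a} = (\<Union>c. {\<omega> \<in> space M. Z n \<omega> = c \<and> Z (Suc n) \<omega> = a})"
      by auto
    then have "emeasure M {\<omega> \<in> space M. Z (Suc n) \<omega> = a}
        = (\<integral>\<^sup>+c. emeasure M {\<omega> \<in> space M. Z n \<omega> = c \<and> Z (Suc n) \<omega> = a} \<partial>count_space UNIV)"
      by (simp only:) (rule emeasure_UN_countable, auto simp: disjoint_family_on_def)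
    also have "\<dots> = (\<integral>\<^sup>+c. ennreal (pmf (chain_law K z n) c) * ennreal (pmf (K c) a) \<partial>count_space UNIV)"
      by (simp add: markov_chain_on_joint[OF mc] Suc.IH)
    also have "\<dots> = ennreal (pmf (chain_law K z (Suc n)) a)"
      by (simp add: ennreal_pmf_bind nn_integral_measure_pmf)
    finally show ?case .
  qed
  then show ?thesis
    by (intro measure_eqI_countable[of _ UNIV])
      (auto simp: emeasure_distr emeasure_pmf_single vimage_def Int_def conj_commute)
qed

section \<open>Reduction to one quadrant\<close>

text \<open>The quadrants are half-open; the fallback case is \<open>x > 0\<close>, \<open>y \<le> 0\<close>, apart from the origin.\<close>

definition canon :: "int \<times> int \<Rightarrow> int \<times> int" where
  "canon = (\<lambda>(x, y).
     if x \<ge> 0 \<and> y > 0 then (x, y)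
     else if x < 0 \<and> y \<ge> 0 then (y, - x)
     else if x \<le> 0 \<and> y < 0 then (- x, - y)
     else (- y, x))"

text \<open>The axis step is the urn's move from \<open>(0, v)\<close> to
  \<open>(-1, v - 1)\<close>, rotated back. It fixes \<open>(0, 1)\<close>: the urn circulates among
  the four points with \<open>|x| + |y| = 1\<close>, but modulo rotation the target is
  absorbing.\<close>

definition quadrant_step :: "int \<times> int \<Rightarrow> (int \<times> int) pmf" where
  "quadrant_step = (\<lambda>(u, v).
     if u = 0 then return_pmf (v - 1, 1)
     else map_pmf (\<lambda>b. if b then (u, v + 1) else (u - 1, v))
       (bernoulli_pmf (real_of_int u / real_of_int (u + v))))"

definition quadrant :: "(int \<times> int) set" where
  "quadrant = {(u, v). u \<ge> 0 \<and> v \<ge> 1}"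

lemma bernoulli_pmf_flip:
  assumes "0 \<le> p" "p \<le> 1"
  shows "map_pmf Not (bernoulli_pmf p) = bernoulli_pmf (1 - p)"
proof (rule pmf_eqI)
  fix b
  have "pmf (map_pmf Not (bernoulli_pmf p)) (Not (\<not> b)) = pmf (bernoulli_pmf p) (\<not> b)"
    by (rule pmf_map_inj') (auto simp: inj_def)
  then show "pmf (map_pmf Not (bernoulli_pmf p)) b = pmf (bernoulli_pmf (1 - p)) b"
    using assms by (cases b) auto
qed

text \<open>A quarter turn exchanges the roles of the coordinates, so the urn's coin becomes the
  complementary one.\<close>

lemma quadrant_step_flip:
  assumes "u > 0" "v > 0"
  shows "map_pmf (\<lambda>b. if b then (u - 1, v) else (u, v + 1))
       (bernoulli_pmf (real_of_int v / real_of_int (v + u))) = quadrant_step (u, v)"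
proof -
  have "real_of_int v / real_of_int (v + u) = 1 - real_of_int u / real_of_int (u + v)"
    using assms by (simp add: field_simps)
  moreover have "real_of_int u / real_of_int (u + v) \<le> 1" "0 \<le> real_of_int u / real_of_int (u + v)"
    using assms by (auto simp: field_simps)
  ultimately have "bernoulli_pmf (real_of_int v / real_of_int (v + u)) =
      map_pmf Not (bernoulli_pmf (real_of_int u / real_of_int (u + v)))"
    by (simp only: bernoulli_pmf_flip)
  then show ?thesis using assms
    by (auto simp: quadrant_step_def map_pmf_comp intro!: map_pmf_cong)
qed

text \<open>The urn's rule commutes with quarter turns. Inside the second and fourth quadrants
  \<open>canon\<close> is an odd number of quarter turns, which calls for the flipped coin.\<close>

lemma canon_leaky_urn_step:
  assumes "z \<noteq> (0, 0)"
  shows "map_pmf canon (leaky_urn_step z) = quadrant_step (canon z)"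
proof -
  obtain x y where z: "z = (x, y)" by (cases z)
  consider "x = 0" | "x \<noteq> 0" "y = 0" | "x > 0" "y > 0" | "x < 0" "y > 0" | "x < 0" "y < 0" | "x > 0" "y < 0"
    by linarith
  then show ?thesis
  proof cases
    case 1
    then show ?thesis using assms
      by (auto simp: z canon_def leaky_urn_step_def quadrant_step_def sgn_if)
  next
    case 2
    then show ?thesis
      by (auto simp: z canon_def leaky_urn_step_def quadrant_step_def sgn_if)
  next
    case 3
    then have "canon (if b then (x, y + sgn x) else (x - sgn y, y)) = (if b then (x, y + 1) else (x - 1, y))" for b
      by (auto simp: canon_def)
    moreover have "canon (x, y) = (x, y)" using 3 by (simp add: canon_def)
    ultimately show ?thesis using 3
      by (simp add: z leaky_urn_step_def quadrant_step_def map_pmf_comp)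
  next
    case 4
    then have "canon (if b then (x, y + sgn x) else (x - sgn y, y)) = (if b then (y - 1, - x) else (y, - x + 1))" for b
      by (auto simp: canon_def)
    moreover have "canon (x, y) = (y, - x)" using 4 by (simp add: canon_def)
    ultimately show ?thesis using 4 quadrant_step_flip[of y "- x"]
      by (simp add: z leaky_urn_step_def map_pmf_comp)
  next
    case 5
    then have "canon (if b then (x, y + sgn x) else (x - sgn y, y)) = (if b then (- x, - y + 1) else (- x - 1, - y))" for b
      by (auto simp: canon_def)
    moreover have "canon (x, y) = (- x, - y)" using 5 by (simp add: canon_def)
    ultimately show ?thesis using 5
      by (simp add: z leaky_urn_step_def quadrant_step_def map_pmf_comp minus_diff_commute)
  next
    case 6
    then have "canon (if b then (x, y + sgn x) else (x - sgn y, y)) = (if b then (- y - 1, x) else (- y, x + 1))" for b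
      by (auto simp: canon_def)
    moreover have "canon (x, y) = (- y, x)" using 6 by (simp add: canon_def)
    ultimately show ?thesis using 6 quadrant_step_flip[of "- y" x]
      by (simp add: z leaky_urn_step_def map_pmf_comp)
  qed
qed

lemma canon_in_quadrant: "z \<noteq> (0, 0) \<Longrightarrow> canon z \<in> quadrant"
  by (cases z) (auto simp: canon_def quadrant_def)

text \<open>The four unit vectors form one rotation orbit, so \<open>urn_tau\<close> is the hitting
  time of \<open>(0, 1)\<close> by the rotated chain.\<close>

lemma canon_eq_target_iff: "canon (x, y) = (0, 1) \<longleftrightarrow> \<bar>x\<bar> + \<bar>y\<bar> = 1"
  by (auto simp: canon_def)

lemma set_quadrant_step:
  assumes "z \<in> quadrant"
  shows "set_pmf (quadrant_step z) \<subseteq> quadrant"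
  using assms by (auto simp: quadrant_def quadrant_step_def split: if_splits)

lemma set_leaky_urn_step:
  assumes "z \<noteq> (0, 0)" "z' \<in> set_pmf (leaky_urn_step z)"
  shows "z' \<noteq> (0, 0)" "canon z' \<in> set_pmf (quadrant_step (canon z))"
proof -
  have "canon ` set_pmf (leaky_urn_step z) = set_pmf (quadrant_step (canon z))"
    using canon_leaky_urn_step[OF assms(1)] by (metis set_map_pmf)
  then show *: "canon z' \<in> set_pmf (quadrant_step (canon z))" using assms(2) by blast
  have "canon z' \<in> quadrant"
    using * set_quadrant_step[OF canon_in_quadrant[OF assms(1)]] by blast
  then show "z' \<noteq> (0, 0)" by (auto simp: canon_def quadrant_def)
qed

text \<open>The commutation with \<open>canon\<close> is available off the origin only, so the
  support is first shown to avoid it.\<close>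

lemma canon_chain_law:
  assumes "z \<noteq> (0, 0)"
  shows "map_pmf canon (chain_law leaky_urn_step z n) = chain_law quadrant_step (canon z) n"
proof -
  have supp: "z' \<noteq> (0, 0)" if "z' \<in> set_pmf (chain_law leaky_urn_step z n)" for n z'
    using that
  proof (induction n arbitrary: z')
    case (Suc n)
    then obtain y where "y \<in> set_pmf (chain_law leaky_urn_step z n)" "z' \<in> set_pmf (leaky_urn_step y)"
      by auto
    then show ?case using Suc.IH set_leaky_urn_step(1) by blast
  qed (use assms in simp)
  show ?thesis
  proof (induction n)
    case (Suc n)
    have "map_pmf canon (chain_law leaky_urn_step z (Suc n))
        = bind_pmf (chain_law leaky_urn_step z n) (\<lambda>z. map_pmf canon (leaky_urn_step z))"
      by (simp add: map_bind_pmf)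
    also have "\<dots> = bind_pmf (chain_law leaky_urn_step z n) (\<lambda>z. quadrant_step (canon z))"
      using supp by (intro bind_pmf_cong refl canon_leaky_urn_step) auto
    also have "\<dots> = bind_pmf (map_pmf canon (chain_law leaky_urn_step z n)) quadrant_step"
      by (simp add: bind_map_pmf)
    finally show ?case by (simp add: Suc.IH)
  qed simp
qed

section \<open>Survival probabilities\<close>

abbreviation on_ints :: "(real \<Rightarrow> real \<Rightarrow> real) \<Rightarrow> int \<times> int \<Rightarrow> real" where
  "on_ints f \<equiv> \<lambda>(u, v). f (real_of_int u) (real_of_int v)"

abbreviation mean :: "'s pmf \<Rightarrow> ('s \<Rightarrow> real) \<Rightarrow> real" where
  "mean p f \<equiv> measure_pmf.expectation p f"

section \<open>Expectations under finitely supported laws\<close>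

lemma finite_set_chain_law:
  assumes "\<And>z. finite (set_pmf (K z))"
  shows "finite (set_pmf (chain_law K z n))"
  using assms by (induction n) auto

lemma mean_chain_law_Suc:
  assumes "\<And>z. finite (set_pmf (K z))"
  shows "mean (chain_law K z (Suc n)) f = mean (chain_law K z n) (\<lambda>z. mean (K z) f)"
proof -
  have fin: "finite (set_pmf (chain_law K z n))" by (rule finite_set_chain_law) fact
  show ?thesis
    unfolding chain_law.simps
    by (subst pmf_expectation_bind[OF fin], use assms in simp, simp,
        subst integral_measure_pmf[OF fin]) auto
qed

lemma mean_mono:
  assumes "finite (set_pmf p)" "\<And>z. z \<in> set_pmf p \<Longrightarrow> f z \<le> g z"
  shows "mean p f \<le> mean p g"
  using assms by (intro integral_mono_AE integrable_measure_pmf_finite) (auto simp: AE_measure_pmf_iff)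

lemma mean_cong:
  assumes "\<And>z. z \<in> set_pmf p \<Longrightarrow> f z = g z"
  shows "mean p f = mean p g"
  using assms by (intro integral_cong_AE) (auto simp: AE_measure_pmf_iff)

lemma finite_set_quadrant_step: "finite (set_pmf (quadrant_step z))"
  by (cases z) (auto simp: quadrant_step_def)

lemma mean_quadrant_step:
  assumes "u \<ge> 0" "v \<ge> 1"
  shows "mean (quadrant_step (u, v)) f =
    (if u = 0 then f (v - 1, 1)
     else real_of_int u / (real_of_int u + real_of_int v) * f (u, v + 1)
        + real_of_int v / (real_of_int u + real_of_int v) * f (u - 1, v))"
proof (cases "u = 0")
  case False
  let ?p = "real_of_int u / real_of_int (u + v)"
  have p: "0 \<le> ?p" "?p \<le> 1" using assms by (auto simp: field_simps)
  have q: "1 - ?p = real_of_int v / real_of_int (u + v)" using assms False by (simp add: field_simps)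
  have "mean (quadrant_step (u, v)) f = f (u, v + 1) * ?p + f (u - 1, v) * (1 - ?p)"
    using False p by (simp add: quadrant_step_def)
  then show ?thesis using False unfolding q by (simp add: mult.commute)
qed (simp add: quadrant_step_def)

text \<open>Integrality leaves a gap above 0; the value 2 is attained at \<open>(1, 1)\<close> and
  \<open>(0, 2)\<close>.\<close>

lemma energy_ge_2:
  assumes "z \<in> quadrant" "z \<noteq> (0, 1)"
  shows "on_ints energy z \<ge> 2"
proof -
  obtain u v where z: "z = (u, v)" by (cases z)
  have uv: "u \<ge> 0" "v \<ge> 1" and or: "u \<ge> 1 \<or> v \<ge> 2" using assms by (auto simp: z quadrant_def)
  have "u * (u + 1) + v * (v - 1) \<ge> 2"
  proof (cases "u \<ge> 1")
    case True
    then have "1 * (1 + 1) \<le> u * (u + 1)" by (intro mult_mono) auto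
    moreover have "0 \<le> v * (v - 1)" using uv by simp
    ultimately show ?thesis by simp
  next
    case False
    then have "2 * 1 \<le> v * (v - 1)" using or by (intro mult_mono) auto
    moreover have "0 \<le> u * (u + 1)" using uv by simp
    ultimately show ?thesis by simp
  qed
  then have "real_of_int (u * (u + 1) + v * (v - 1)) \<ge> 2" by linarith
  then show ?thesis by (simp add: z energy_def)
qed

lemma energy_target: "on_ints energy (0, 1) = 0"
  by (simp add: energy_def)

lemma energy_nonneg: "z \<in> quadrant \<Longrightarrow> on_ints energy z \<ge> 0"
  using energy_ge_2[of z] energy_target by (cases "z = (0, 1)") auto

section \<open>One-step drift of the energy, its square and the Lyapunov function\<close>

lemma mean_energy_step:
  assumes "z \<in> quadrant"
  shows "mean (quadrant_step z) (on_ints energy) = on_ints energy z"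
proof -
  obtain u v where z: "z = (u, v)" by (cases z)
  have uv: "u \<ge> 0" "v \<ge> 1" using assms by (auto simp: z quadrant_def)
  have pos: "real_of_int u + real_of_int v > 0" using uv by linarith
  show ?thesis
    unfolding z mean_quadrant_step[OF uv] using pos
    by (simp add: energy_def divide_simps) (simp add: algebra_simps)
qed

text \<open>Off the axis the conditional variance is \<open>4 u v \<le> (u + v)^2 \<le> 3 W\<close>;
  on the axis the energy does not change.\<close>

lemma mean_energy_square_step:
  assumes "z \<in> quadrant"
  shows "mean (quadrant_step z) (\<lambda>z. (on_ints energy z)\<^sup>2) \<le> (on_ints energy z)\<^sup>2 + 3 * on_ints energy z"
proof -
  obtain u v where z: "z = (u, v)" by (cases z)
  have uv: "u \<ge> 0" "v \<ge> 1" using assms by (auto simp: z quadrant_def)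
  show ?thesis
  proof (cases "u = 0")
    case True
    have "energy (real_of_int v - 1) 1 = energy 0 (real_of_int v)" by (simp add: energy_def algebra_simps)
    then show ?thesis
      using energy_nonneg[OF assms] unfolding z mean_quadrant_step[OF uv] by (simp add: True)
  next
    case False
    define a where "a = real_of_int u"
    define b where "b = real_of_int v"
    have ab: "a \<ge> 1" "b \<ge> 1" using uv False by (auto simp: a_def b_def)
    define W where "W = energy a b"
    have W1: "energy a (b + 1) = W + 2 * b" and W2: "energy (a - 1) b = W - 2 * a"
      by (simp_all add: W_def energy_def algebra_simps)
    have "a / (a + b) * (W + 2 * b)\<^sup>2 + b / (a + b) * (W - 2 * a)\<^sup>2 = W\<^sup>2 + 4 * (a * b)"
      using ab by (simp add: divide_simps) (simp add: algebra_simps power2_eq_square)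
    also have "4 * (a * b) \<le> (a + b)\<^sup>2"
      using zero_le_power2[of "a - b"] by (simp add: power2_eq_square algebra_simps)
    also have "(a + b)\<^sup>2 \<le> 3 * W" unfolding W_def by (rule energy_ge_square) fact+
    finally show ?thesis
      unfolding z mean_quadrant_step[OF uv] using False
      by (simp flip: a_def b_def add: W1 W2 W_def[symmetric])
  qed
qed

text \<open>Off the target \<open>W \<ge> 2\<close>, and \<open>W / (W + 30000)\<close> increases in
  \<open>W\<close>, so the drift is at least \<open>2 / (3 * 30002) > 1 / 50000\<close>.\<close>

lemma mean_lyapunov_step:
  assumes "z \<in> quadrant"
  shows "mean (quadrant_step z) (on_ints lyapunov) \<ge> on_ints lyapunov z + indicator (- {(0, 1)}) z / 50000"
proof -
  obtain u v where z: "z = (u, v)" by (cases z)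
  have uv: "u \<ge> 0" "v \<ge> 1" using assms by (auto simp: z quadrant_def)
  define W where "W = on_ints energy z"
  have W0: "W \<ge> 0" using energy_nonneg[OF assms] by (simp add: W_def)
  have "indicator (- {(0, 1)}) z / 50000 \<le> W / (3 * (W + 30000))"
  proof (cases "z = (0, 1)")
    case False
    then have "W \<ge> 2" using energy_ge_2[OF assms] by (simp add: W_def)
    then show ?thesis using False by (simp add: field_simps)
  qed (use W0 in auto)
  moreover have "mean (quadrant_step z) (on_ints lyapunov) \<ge> on_ints lyapunov z + W / (3 * (W + 30000))"
  proof (cases "u = 0")
    case True
    have "W / (3 * (W + 30000)) \<le> 2 / 3 * W / (W + 30000)" using W0 by (simp add: field_simps)
    then show ?thesis
      unfolding z mean_quadrant_step[OF uv] using lyapunov_axis_step[of "real_of_int v"]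
      by (simp add: True W_def z)
  next
    case False
    then have "real_of_int u \<ge> 1" "real_of_int v \<ge> 1" using uv by auto
    from lyapunov_drift[OF this] show ?thesis
      unfolding z mean_quadrant_step[OF uv] using False by (simp add: W_def z)
  qed
  ultimately show ?thesis by linarith
qed

section \<open>Tail bounds for the chain from a fixed starting point\<close>

locale quadrant_chain =
  fixes z :: "int \<times> int"
  assumes z_quadrant: "z \<in> quadrant"
begin

definition law :: "nat \<Rightarrow> (int \<times> int) pmf" where
  "law = chain_law quadrant_step z"

text \<open>Since the target is absorbing, this one-time probability is the tail of the absorption
  time.\<close>

definition survival :: "nat \<Rightarrow> real" where
  "survival n = measure_pmf.prob (law n) (- {(0, 1)})"

lemma finite_law: "finite (set_pmf (law n))"
  unfolding law_def by (intro finite_set_chain_law finite_set_quadrant_step)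

lemma integrable_law: "integrable (law n) (f :: _ \<Rightarrow> real)"
  by (intro integrable_measure_pmf_finite finite_law)

lemma mean_law_0: "mean (law 0) f = f z"
  by (simp add: law_def)

lemma mean_law_Suc: "mean (law (Suc n)) f = mean (law n) (\<lambda>z. mean (quadrant_step z) f)"
  unfolding law_def by (rule mean_chain_law_Suc) (rule finite_set_quadrant_step)

lemma survival_eq_mean: "survival n = mean (law n) (indicator (- {(0, 1)}))"
  by (simp add: survival_def)

text \<open>Crossing the axis preserves the coordinate sum, and other moves change it by one. The
  crude linear bound suffices because it will enter through a logarithm only.\<close>

lemma set_law:
  assumes "x \<in> set_pmf (law n)"
  shows "x \<in> quadrant" "fst x + snd x \<le> fst z + snd z + int n"
proof -
  have "x \<in> quadrant \<and> fst x + snd x \<le> fst z + snd z + int n"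
    using assms
  proof (induction n arbitrary: x)
    case (Suc n)
    then obtain y where y: "y \<in> set_pmf (law n)" "x \<in> set_pmf (quadrant_step y)"
      by (auto simp: law_def)
    have "y \<in> quadrant" "fst y + snd y \<le> fst z + snd z + int n" using Suc.IH[OF y(1)] by auto
    moreover have "x \<in> quadrant" using set_quadrant_step[OF \<open>y \<in> quadrant\<close>] y by blast
    moreover have "fst x + snd x \<le> fst y + snd y + 1"
      using y(2) \<open>y \<in> quadrant\<close> by (auto simp: quadrant_step_def quadrant_def split: if_splits prod.splits)
    ultimately show ?case by auto
  qed (use z_quadrant in \<open>auto simp: law_def\<close>)
  then show "x \<in> quadrant" "fst x + snd x \<le> fst z + snd z + int n" by auto
qed

lemma mean_energy: "mean (law n) (on_ints energy) = on_ints energy z"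
proof (induction n)
  case (Suc n)
  have "mean (law (Suc n)) (on_ints energy) = mean (law n) (on_ints energy)"
    unfolding mean_law_Suc by (intro mean_cong mean_energy_step set_law)
  then show ?case by (simp add: Suc)
qed (rule mean_law_0)

lemma mean_energy_square:
  "mean (law n) (\<lambda>z. (on_ints energy z)\<^sup>2) \<le> (on_ints energy z)\<^sup>2 + 3 * real n * on_ints energy z"
proof (induction n)
  case (Suc n)
  have "mean (law (Suc n)) (\<lambda>z. (on_ints energy z)\<^sup>2)
      \<le> mean (law n) (\<lambda>z. (on_ints energy z)\<^sup>2 + 3 * on_ints energy z)"
    unfolding mean_law_Suc by (intro mean_mono mean_energy_square_step set_law finite_law)
  also have "\<dots> = mean (law n) (\<lambda>z. (on_ints energy z)\<^sup>2) + 3 * on_ints energy z"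
    by (subst Bochner_Integration.integral_add) (auto simp: integrable_law mean_energy)
  finally show ?case using Suc by (simp add: algebra_simps)
qed (simp add: mean_law_0)

lemma mean_lyapunov:
  "mean (law n) (on_ints lyapunov) \<ge> on_ints lyapunov z + (\<Sum>k<n. survival k) / 50000"
proof (induction n)
  case (Suc n)
  have "mean (law (Suc n)) (on_ints lyapunov)
      \<ge> mean (law n) (\<lambda>z. on_ints lyapunov z + indicator (- {(0, 1)}) z / 50000)"
    unfolding mean_law_Suc by (intro mean_mono mean_lyapunov_step set_law finite_law)
  also have "mean (law n) (\<lambda>z. on_ints lyapunov z + indicator (- {(0, 1)}) z / 50000)
     = mean (law n) (on_ints lyapunov) + survival n / 50000"
    by (subst Bochner_Integration.integral_add) (auto simp: integrable_law survival_eq_mean)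
  finally show ?case using Suc by (simp add: add_divide_distrib)
qed (simp add: mean_law_0)

lemma survival_antimono: "k \<le> n \<Longrightarrow> survival n \<le> survival k"
proof (induction n rule: dec_induct)
  case (step n)
  have "mean (quadrant_step x) (indicator (- {(0, 1)})) \<le> (indicator (- {(0, 1)}) x :: real)" for x
  proof (cases "x = (0, 1)")
    case True then show ?thesis by (simp add: quadrant_step_def)
  next
    case False
    have "mean (quadrant_step x) (indicator (- {(0, 1)})) \<le> 1"
      by (simp add: measure_pmf.prob_le_1)
    then show ?thesis using False by simp
  qed
  then have "survival (Suc n) \<le> survival n"
    unfolding survival_eq_mean mean_law_Suc by (intro mean_mono finite_law)
  then show ?case using step by simp
qed simp

text \<open>The logarithm in the Lyapunov function is bounded deterministically; the remaining
  factor is the shifted energy, whose mean is constant. Comparison with the accumulated drift bounds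
  the sum of survival probabilities.\<close>

lemma survival_upper:
  "real (Suc n) * survival n \<le> 50000 * ((on_ints energy z + 30000) *
      (ln ((real_of_int (fst z + snd z) + real (Suc n))\<^sup>2 + 30000) + 1) - on_ints lyapunov z)"
proof -
  define R where "R = ln ((real_of_int (fst z + snd z) + real (Suc n))\<^sup>2 + 30000) + 1"
  have "mean (law (Suc n)) (on_ints lyapunov) \<le> mean (law (Suc n)) (\<lambda>x. (on_ints energy x + 30000) * R)"
  proof (intro mean_mono finite_law)
    fix x assume x: "x \<in> set_pmf (law (Suc n))"
    obtain u v where uv: "x = (u, v)" by (cases x)
    have q: "u \<ge> 0" "v \<ge> 1" using set_law(1)[OF x] by (auto simp: uv quadrant_def)
    have le: "real_of_int u + real_of_int v \<le> real_of_int (fst z + snd z) + real (Suc n)"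
      using set_law(2)[OF x] unfolding uv fst_conv snd_conv by linarith
    have W0: "energy (real_of_int u) (real_of_int v) \<ge> 0"
      using energy_nonneg[OF set_law(1)[OF x]] by (simp add: uv)
    have "energy (real_of_int u) (real_of_int v) \<le> (real_of_int u + real_of_int v)\<^sup>2"
      using q by (intro energy_le_square) auto
    also have "\<dots> \<le> (real_of_int (fst z + snd z) + real (Suc n))\<^sup>2"
      using le q by (intro power_mono) auto
    finally have "ln (energy (real_of_int u) (real_of_int v) + 30000) + 1 \<le> R"
      using W0 unfolding R_def by (intro add_right_mono ln_mono) auto
    then have "(energy (real_of_int u) (real_of_int v) + 30000) * (ln (energy (real_of_int u) (real_of_int v) + 30000) + 1)
      \<le> (energy (real_of_int u) (real_of_int v) + 30000) * R"
      using W0 by (intro mult_left_mono) auto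
    moreover have "real_of_int u = 0 \<or> real_of_int u \<ge> 1" using q by auto
    then have "lyapunov (real_of_int u) (real_of_int v) \<le> (energy (real_of_int u) (real_of_int v) + 30000)
        * (ln (energy (real_of_int u) (real_of_int v) + 30000) + 1)"
      using q by (intro lyapunov_le) auto
    ultimately show "on_ints lyapunov x \<le> (on_ints energy x + 30000) * R" by (simp add: uv)
  qed
  also have "\<dots> = mean (law (Suc n)) (\<lambda>x. on_ints energy x + 30000) * R" by simp
  also have "mean (law (Suc n)) (\<lambda>x. on_ints energy x + 30000) = on_ints energy z + 30000"
    by (subst Bochner_Integration.integral_add) (auto simp: integrable_law mean_energy)
  finally have "on_ints lyapunov z + (\<Sum>k<Suc n. survival k) / 50000 \<le> (on_ints energy z + 30000) * R"
    using mean_lyapunov[of "Suc n"] by linarith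
  \<comment> \<open>Time \<open>Suc n\<close> was used above so that the sum has
    \<open>n + 1\<close> terms, each at least \<open>survival n\<close>.\<close>
  moreover have "(\<Sum>k<Suc n. survival k) \<ge> (\<Sum>k<Suc n. survival n)"
    by (intro sum_mono survival_antimono) auto
  ultimately show ?thesis by (simp add: R_def field_simps)
qed

text \<open>The logarithm is traded for a small power through
  \<open>ln N \<le> N powr \<delta> / \<delta>\<close>. As \<open>N powr \<delta> \<ge> 1\<close>,
  constants may be multiplied by it too; \<open>D\<close> collects them all.\<close>

lemma survival_powr_bound:
  assumes "\<delta> > 0"
  shows "\<exists>C\<ge>0. \<forall>n. survival n \<le> C * real (Suc n) powr (\<delta> - 1)"
proof -
  define m where "m = real_of_int (fst z + snd z)"
  define E where "E = on_ints energy z + 30000"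
  define B where "B = (m + 1)\<^sup>2 + 30000"
  define D where "D = 50000 * (E * (ln B + 2 / \<delta> + 1) + \<bar>on_ints lyapunov z\<bar>)"
  have m: "m \<ge> 0" using z_quadrant by (auto simp: m_def quadrant_def)
  have E: "E \<ge> 0" using energy_nonneg[OF z_quadrant] by (simp add: E_def)
  have B: "B \<ge> 1" by (simp add: B_def add_nonneg_pos)
  have D: "D \<ge> 0" unfolding D_def using E B assms by (intro mult_nonneg_nonneg add_nonneg_nonneg) auto
  have "survival n \<le> D * real (Suc n) powr (\<delta> - 1)" for n
  proof -
    define N where "N = real (Suc n)"
    have N: "N \<ge> 1" by (simp add: N_def)
    have N\<delta>: "N powr \<delta> \<ge> 1" using N assms by (simp add: ge_one_powr_ge_zero)
    have "m + N \<le> (m + 1) * N" using m N mult_left_mono[of 1 N m] by (simp add: algebra_simps)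
    then have "(m + N)\<^sup>2 \<le> ((m + 1) * N)\<^sup>2" using m N by (intro power_mono) auto
    moreover have "30000 \<le> 30000 * N\<^sup>2" using N by simp
    ultimately have "(m + N)\<^sup>2 + 30000 \<le> B * N\<^sup>2"
      unfolding B_def power_mult_distrib distrib_right[of _ _ "N\<^sup>2"] by (rule add_mono)
    then have "ln ((m + N)\<^sup>2 + 30000) \<le> ln (B * N\<^sup>2)" by (intro ln_mono) (auto simp: add_nonneg_pos)
    also have "\<dots> = ln B + 2 * ln N" using B N by (simp add: ln_mult ln_realpow)
    also have "\<dots> \<le> ln B + 2 * (N powr \<delta> / \<delta>)"
      using ln_powr_bound[OF N assms] by simp
    finally have "ln ((m + N)\<^sup>2 + 30000) + 1 \<le> ln B * 1 + 2 / \<delta> * N powr \<delta> + 1" by simp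
    also have "\<dots> \<le> ln B * N powr \<delta> + 2 / \<delta> * N powr \<delta> + N powr \<delta>"
      using N\<delta> B assms by (intro add_mono mult_left_mono) auto
    also have "\<dots> = (ln B + 2 / \<delta> + 1) * N powr \<delta>" by (simp add: algebra_simps)
    finally have "E * (ln ((m + N)\<^sup>2 + 30000) + 1) \<le> E * ((ln B + 2 / \<delta> + 1) * N powr \<delta>)"
      using E by (intro mult_left_mono) auto
    moreover have "- on_ints lyapunov z \<le> \<bar>on_ints lyapunov z\<bar> * N powr \<delta>"
      using N\<delta> mult_left_mono[OF N\<delta>, of "\<bar>on_ints lyapunov z\<bar>"] by linarith
    moreover have "N * survival n \<le> 50000 * (E * (ln ((m + N)\<^sup>2 + 30000) + 1) - on_ints lyapunov z)"
      using survival_upper[of n] unfolding N_def E_def m_def .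
    moreover have "s \<le> 50000 * (b + d)" if "a \<le> b" "- c \<le> d" "s \<le> 50000 * (a - c)" for a b c d s :: real
      by (rule order_trans[OF that(3)]) (use that in simp)
    ultimately have "N * survival n \<le> 50000 * (E * ((ln B + 2 / \<delta> + 1) * N powr \<delta>) + \<bar>on_ints lyapunov z\<bar> * N powr \<delta>)"
      by blast
    also have "\<dots> = D * N powr \<delta>" by (simp add: D_def algebra_simps)
    finally have "survival n \<le> D * (N powr \<delta> / N)" using N by (simp add: field_simps)
    also have "N powr \<delta> / N = N powr (\<delta> - 1)" using N by (simp add: powr_diff)
    finally show ?thesis by (simp add: N_def)
  qed
  then show ?thesis using D by blast
qed

text \<open>The energy keeps its mean but vanishes at the target, so the surviving mass carries all
  of it; the linear second moment bound limits how small that mass can be.\<close>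

lemma survival_lower:
  assumes "z \<noteq> (0, 1)"
  shows "survival n \<ge> 1 / (2 * real (Suc n))"
proof -
  define W where "W = on_ints energy z"
  have W: "W \<ge> 2" unfolding W_def by (rule energy_ge_2[OF z_quadrant assms])
  \<comment> \<open>AM-GM with this weight is the Cauchy-Schwarz bound \<open>(E W)\<^sup>2 \<le> E W\<^sup>2 P(W > 0)\<close>.\<close>
  define s where "s = W + 3 * real n"
  have s: "s > 0" using W by (simp add: s_def)
  have "mean (law n) (on_ints energy)
      \<le> mean (law n) (\<lambda>x. (on_ints energy x)\<^sup>2 / (2 * s) + s / 2 * indicator (- {(0, 1)}) x)"
  proof (intro mean_mono finite_law)
    fix x assume x: "x \<in> set_pmf (law n)"
    show "on_ints energy x \<le> (on_ints energy x)\<^sup>2 / (2 * s) + s / 2 * indicator (- {(0, 1)}) x"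
    proof (cases "x = (0, 1)")
      case False
      have "0 \<le> (on_ints energy x - s)\<^sup>2" by simp
      then show ?thesis using s False by (simp add: field_simps power2_eq_square)
    qed (simp add: energy_def)
  qed
  also have "\<dots> = mean (law n) (\<lambda>x. (on_ints energy x)\<^sup>2) / (2 * s) + s / 2 * survival n"
    by (subst Bochner_Integration.integral_add) (auto simp: integrable_law survival_eq_mean)
  also have "mean (law n) (\<lambda>x. (on_ints energy x)\<^sup>2) / (2 * s) \<le> (W * s) / (2 * s)"
    using mean_energy_square[of n] s
    by (intro divide_right_mono) (auto simp: s_def W_def algebra_simps power2_eq_square)
  also have "(W * s) / (2 * s) = W / 2" using s by simp
  finally have "W / 2 \<le> s / 2 * survival n" by (simp add: mean_energy W_def)
  then have "W / s \<le> survival n" using s by (simp add: field_simps)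
  \<comment> \<open>\<open>W / (W + 3 n)\<close> increases in \<open>W\<close>, and already at
    \<open>W = 2\<close> it is at least \<open>1 / (2 n + 2)\<close>.\<close>
  moreover have "1 / (2 * real (Suc n)) \<le> W / s"
  proof -
    have "real n * 2 \<le> real n * W" using W by (intro mult_left_mono) auto
    then show ?thesis using s W by (simp add: s_def field_simps)
  qed
  ultimately show ?thesis by linarith
qed

end

section \<open>Moments of the absorption time\<close>

text \<open>Telescoping of \<open>(t + 1)^p - t^p \<le> (t + 1)^(p - 1)\<close>. It turns a
  fractional moment into a weighted sum of tail probabilities.\<close>

lemma powr_le_sum_powr:
  fixes p :: real
  assumes "0 < p" "p < 1"
  shows "real t powr p \<le> (\<Sum>n<t. real (Suc n) powr (p - 1))"
proof (induction t)
  case (Suc t)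
  define N where "N = real (Suc t)"
  have "real t = real t powr (1 - p) * real t powr p"
    using assms by (cases "t = 0") (auto simp flip: powr_add)
  also have "\<dots> \<le> N powr (1 - p) * real t powr p"
    using assms by (intro mult_right_mono powr_mono2) (auto simp: N_def)
  finally have "N powr (p - 1) * (N - 1) \<le> N powr (p - 1) * (N powr (1 - p) * real t powr p)"
    by (intro mult_left_mono) (auto simp: N_def)
  also have "\<dots> = real t powr p"
    unfolding mult.assoc[symmetric] powr_add[symmetric] by (simp add: N_def)
  finally have "N powr (p - 1) * N - N powr (p - 1) \<le> real t powr p" by (simp add: algebra_simps)
  moreover have "N powr (p - 1) * N = N powr p" by (simp add: N_def powr_diff)
  ultimately show ?case using Suc by (simp add: N_def)
qed (use assms in simp)

lemma less_Inf_enat_image_iff: "enat n < Inf (enat ` A) \<longleftrightarrow> (\<forall>k\<le>n. k \<notin> A)"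
proof
  assume *: "enat n < Inf (enat ` A)"
  show "\<forall>k\<le>n. k \<notin> A"
  proof (intro allI impI notI)
    fix k assume "k \<le> n" "k \<in> A"
    then have "Inf (enat ` A) \<le> enat k" "enat k \<le> enat n" by (auto intro: Inf_lower)
    then show False using * by (meson leD order_trans)
  qed
next
  assume "\<forall>k\<le>n. k \<notin> A"
  then have "enat (Suc n) \<le> Inf (enat ` A)"
    by (intro Inf_greatest) (auto simp: not_less_eq_eq)
  then show "enat n < Inf (enat ` A)" by (meson enat_ord_simps(2) lessI less_le_trans)
qed

theorem theorem2p3:
  fixes M :: "'a measure" and Z :: "nat \<Rightarrow> 'a \<Rightarrow> int \<times> int" and z0 :: nat
  assumes "z0 \<ge> 1"
    and "leaky_urn M Z"
    and "AE \<omega> in M. Z 0 \<omega> = (int z0, 1)"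
  shows "\<P>(\<omega> in M. urn_tau Z \<omega> < \<infinity>) = 1 \<and>
    (\<forall>\<epsilon>::real. \<epsilon> > 0 \<longrightarrow>
       (\<integral>\<^sup>+ \<omega>. enat_powr (urn_tau Z \<omega>) (1 - \<epsilon>) \<partial>M) < \<infinity> \<and>
       (\<integral>\<^sup>+ \<omega>. enat_powr (urn_tau Z \<omega>) (1 + \<epsilon>) \<partial>M) = \<infinity>)"
proof -

  \<comment> \<open>Transfer of the hitting time to the quadrant chain\<close>
  define z where "z = (int z0, 1::int)"
  have z: "z \<noteq> (0, 0)" "z \<noteq> (0, 1)" "canon z = z" "z \<in> quadrant"
    using assms(1) by (auto simp: z_def canon_def quadrant_def)
  have mc: "markov_chain_on M (UNIV - {(0, 0)}) leaky_urn_step Z"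
    using assms(2) by (simp add: leaky_urn_def)
  interpret prob_space M using mc by (simp add: markov_chain_on_def)
  interpret quadrant_chain z by unfold_locales (rule z(4))
  note [measurable] = markov_chain_on_measurable[OF mc]
  define T where "T = urn_tau Z"
  define D where "D n = {\<omega> \<in> space M. canon (Z n \<omega>) \<noteq> (0, 1)}" for n
  have D [measurable]: "D n \<in> sets M" for n unfolding D_def by measurable
  have T_iff: "enat n < T \<omega> \<longleftrightarrow> (\<forall>k\<le>n. canon (Z k \<omega>) \<noteq> (0, 1))" for n \<omega>
    unfolding T_def urn_tau_def less_Inf_enat_image_iff
    by (auto simp flip: canon_eq_target_iff)

  have nz: "Z n \<omega> \<noteq> (0, 0)" if "\<omega> \<in> space M" for n \<omega>
  proof -
    have "Z n \<in> measurable M (count_space (UNIV - {(0, 0)}))" using mc by (simp add: markov_chain_on_def)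
    from measurable_space[OF this that] show ?thesis by simp
  qed
  \<comment> \<open>\<open>D n\<close> looks at time \<open>n\<close> alone, \<open>n < T\<close> at
    all times up to \<open>n\<close>. They agree once forbidden transitions are excluded, since the
    target is then never left.\<close>
  have D_T: "AE \<omega> in M. \<forall>n. enat n < T \<omega> \<longleftrightarrow> \<omega> \<in> D n"
    using markov_chain_on_AE_step[OF mc]
  proof (rule AE_mp, intro AE_I2 impI allI)
    fix \<omega> n assume \<omega>: "\<omega> \<in> space M" and step: "\<forall>n. Z (Suc n) \<omega> \<in> set_pmf (leaky_urn_step (Z n \<omega>))"
    have absorb: "canon (Z (k + j) \<omega>) = (0, 1)" if "canon (Z k \<omega>) = (0, 1)" for j k
    proof (induction j)
      case (Suc j)
      have "canon (Z (Suc (k + j)) \<omega>) \<in> set_pmf (quadrant_step (canon (Z (k + j) \<omega>)))"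
        using step nz[OF \<omega>] set_leaky_urn_step(2) by blast
      then show ?case by (simp add: Suc quadrant_step_def)
    qed (use that in simp)
    show "enat n < T \<omega> \<longleftrightarrow> \<omega> \<in> D n"
      unfolding T_iff D_def using \<omega> absorb le_Suc_ex by blast
  qed
  have law_D: "emeasure M (D n) = ennreal (survival n)" for n
  proof -
    have "map_pmf canon (chain_law leaky_urn_step z n) = law n"
      using canon_chain_law[OF z(1)] by (simp add: z(3) law_def)
    then have "survival n = measure_pmf.prob (chain_law leaky_urn_step z n) (canon -` (- {(0, 1)}))"
      unfolding survival_def by (metis measure_map_pmf)
    then have "ennreal (survival n) = emeasure (measure_pmf (chain_law leaky_urn_step z n)) (canon -` (- {(0, 1)}))"
      by (simp add: measure_pmf.emeasure_eq_measure)
    also have "measure_pmf (chain_law leaky_urn_step z n) = distr M (count_space UNIV) (Z n)"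
      using markov_chain_on_distr[OF mc] assms(3) unfolding z_def by metis
    also have "emeasure \<dots> (canon -` (- {(0, 1)})) = emeasure M (D n)"
      by (subst emeasure_distr) (auto simp: D_def intro!: arg_cong[where f = "emeasure M"])
    finally show ?thesis by simp
  qed
  have surv0: "survival n \<ge> 0" for n by (simp add: survival_def)

  \<comment> \<open>Almost sure finiteness\<close>
  have T_finite: "AE \<omega> in M. T \<omega> < \<infinity>"
  proof -
    obtain C where C: "\<And>n. survival n \<le> C * real (Suc n) powr (1 / 2 - 1)"
      using survival_powr_bound[of "1 / 2"] by auto
    have "(\<lambda>n. C * real (Suc n) powr (1 / 2 - 1)) \<longlonglongrightarrow> C * 0"
      by (intro tendsto_mult tendsto_const LIMSEQ_Suc[OF tendsto_neg_powr] filterlim_real_sequentially) simp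
    moreover have "measure M (\<Inter>n. D n) \<le> C * real (Suc n) powr (1 / 2 - 1)" for n
    proof -
      have "measure M (\<Inter>n. D n) \<le> measure M (D n)" by (intro finite_measure_mono) auto
      also have "\<dots> = survival n" using law_D[of n] surv0 by (simp add: measure_def)
      finally show ?thesis using C[of n] by linarith
    qed
    ultimately have "measure M (\<Inter>n. D n) \<le> 0"
      by (intro LIMSEQ_le_const) auto
    then have "emeasure M (\<Inter>n. D n) = 0"
      by (simp add: emeasure_eq_measure measure_le_0_iff)
    then have "AE \<omega> in M. \<omega> \<notin> (\<Inter>n. D n)"
      by (intro AE_not_in) (auto simp: null_sets_def)
    then show ?thesis using D_T
    proof eventually_elim
      case (elim \<omega>)
      then show ?case by (cases "T \<omega>") auto
    qed
  qed
  \<comment> \<open>The event is written as a countable union to make it measurable, so that the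
    almost sure statement becomes one about its probability.\<close>
  have "{\<omega> \<in> space M. T \<omega> < \<infinity>} = (\<Union>n. {\<omega> \<in> space M. canon (Z n \<omega>) = (0, 1)})"
  proof -
    have "T \<omega> < \<infinity> \<longleftrightarrow> (\<exists>n. canon (Z n \<omega>) = (0, 1))" for \<omega>
    proof (cases "T \<omega>")
      case (enat t)
      then show ?thesis using T_iff[of t \<omega>] by auto
    next
      case infinity
      then show ?thesis using T_iff[of _ \<omega>] by auto
    qed
    then show ?thesis by auto
  qed
  also have "\<dots> \<in> sets M" by measurable
  finally have "\<P>(\<omega> in M. T \<omega> < \<infinity>) = 1"
    using T_finite by (subst prob_Collect_eq_1) auto

  \<comment> \<open>Finite moments below order one\<close>
  moreover have "(\<integral>\<^sup>+ \<omega>. enat_powr (T \<omega>) (1 - \<epsilon>) \<partial>M) < \<infinity>" if \<epsilon>: "\<epsilon> > 0" for \<epsilon> :: real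
  proof (cases "\<epsilon> < 1")
    case True
    define p where "p = 1 - \<epsilon>"
    have p: "0 < p" "p < 1" using \<epsilon> True by (auto simp: p_def)
    \<comment> \<open>With \<epsilon>/2 spent on the tail bound, the exponents add up to -1 -
      \<epsilon>/2, still summable.\<close>
    obtain C where C: "C \<ge> 0" "\<And>n. survival n \<le> C * real (Suc n) powr (\<epsilon> / 2 - 1)"
      using survival_powr_bound[of "\<epsilon> / 2"] \<epsilon> by auto
    have "(\<integral>\<^sup>+ \<omega>. enat_powr (T \<omega>) p \<partial>M)
        \<le> (\<integral>\<^sup>+ \<omega>. (\<Sum>n. ennreal (real (Suc n) powr (p - 1)) * indicator (D n) \<omega>) \<partial>M)"
    proof (rule nn_integral_mono_AE)
      show "AE \<omega> in M. enat_powr (T \<omega>) p \<le> (\<Sum>n. ennreal (real (Suc n) powr (p - 1)) * indicator (D n) \<omega>)"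
        using D_T T_finite
      proof eventually_elim
        case (elim \<omega>)
        then obtain t where t: "T \<omega> = enat t" by (cases "T \<omega>") auto
        have "enat_powr (T \<omega>) p \<le> ennreal (\<Sum>n<t. real (Suc n) powr (p - 1))"
          using p powr_le_sum_powr[OF p, of t] by (auto simp: enat_powr_def t intro: ennreal_leI)
        also have "\<dots> = (\<Sum>n<t. ennreal (real (Suc n) powr (p - 1)) * indicator (D n) \<omega>)"
          using elim by (subst sum_ennreal[symmetric]) (auto simp: t intro!: sum.cong)
        also have "\<dots> \<le> (\<Sum>n. ennreal (real (Suc n) powr (p - 1)) * indicator (D n) \<omega>)"
          by (intro sum_le_suminf) auto
        finally show ?case .
      qed
    qed
    also have "\<dots> = (\<Sum>n. ennreal (real (Suc n) powr (p - 1)) * ennreal (survival n))"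
      by (subst nn_integral_suminf) (auto simp: nn_integral_cmult_indicator law_D)
    also have "\<dots> \<le> (\<Sum>n. ennreal (C * real (Suc n) powr (- 1 - \<epsilon> / 2)))"
    proof (intro suminf_le summableI)
      fix n
      have "real (Suc n) powr (p - 1) * survival n
          \<le> real (Suc n) powr (p - 1) * (C * real (Suc n) powr (\<epsilon> / 2 - 1))"
        using C(2)[of n] by (intro mult_left_mono) auto
      also have "\<dots> = C * real (Suc n) powr (p - 1 + (\<epsilon> / 2 - 1))" unfolding powr_add by simp
      also have "p - 1 + (\<epsilon> / 2 - 1) = - 1 - \<epsilon> / 2" by (simp add: p_def)
      finally show "ennreal (real (Suc n) powr (p - 1)) * ennreal (survival n)
          \<le> ennreal (C * real (Suc n) powr (- 1 - \<epsilon> / 2))"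
        by (subst ennreal_mult[symmetric]) (auto simp: surv0 intro: ennreal_leI)
    qed
    also have "\<dots> < \<infinity>"
    proof -
      have "summable (\<lambda>n. real (Suc n) powr (- 1 - \<epsilon> / 2))"
        using \<epsilon> by (subst summable_Suc_iff[of "\<lambda>n. real n powr (- 1 - \<epsilon> / 2)"]) (simp add: summable_real_powr_iff)
      then have "(\<Sum>n. ennreal (C * real (Suc n) powr (- 1 - \<epsilon> / 2))) \<noteq> \<top>"
        using C(1) by (intro ennreal_suminf_neq_top summable_mult) auto
      then show ?thesis by (simp add: less_top)
    qed
    finally show ?thesis by (simp add: p_def)
  next
    case False
    \<comment> \<open>Here the exponent is at most 0. The start is not the target, so
      \<open>T \<ge> 1\<close>; this excludes the value \<infinity> that \<open>enat_powr\<close>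
      gives to 0 under a negative exponent.\<close>
    have "AE \<omega> in M. enat_powr (T \<omega>) (1 - \<epsilon>) \<le> 1"
      using assms(3)
    proof eventually_elim
      case (elim \<omega>)
      then have "enat 0 < T \<omega>" unfolding T_iff using z by (auto simp: z_def)
      then have t: "t \<ge> 1" if "T \<omega> = enat t" for t using that by auto
      have "real t powr (1 - \<epsilon>) \<le> 1" if "T \<omega> = enat t" for t
        using powr_mono[of "1 - \<epsilon>" 0 "real t"] False t[OF that] by auto
      then show ?case using t False by (cases "T \<omega>") (auto simp: enat_powr_def)
    qed
    then have "(\<integral>\<^sup>+ \<omega>. enat_powr (T \<omega>) (1 - \<epsilon>) \<partial>M) \<le> (\<integral>\<^sup>+ \<omega>. 1 \<partial>M)"
      by (rule nn_integral_mono_AE)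
    also have "\<dots> < \<infinity>" by (simp add: emeasure_space_1)
    finally show ?thesis .
  qed

  \<comment> \<open>Infinite moments above order one\<close>
  moreover have "(\<integral>\<^sup>+ \<omega>. enat_powr (T \<omega>) (1 + \<epsilon>) \<partial>M) = \<infinity>" if \<epsilon>: "\<epsilon> > 0" for \<epsilon> :: real
  proof -
    \<comment> \<open>The sum is the mean of \<open>T\<close>, which diverges by comparison with the
      harmonic series; \<open>T powr (1 + \<epsilon>)\<close> dominates \<open>T\<close>, the number
      of \<open>n\<close> with \<omega> in \<open>D n\<close>.\<close>
    have "(\<Sum>n. ennreal (survival n)) = \<top>"
    proof (rule ccontr)
      assume "(\<Sum>n. ennreal (survival n)) \<noteq> \<top>"
      then have "summable survival" using surv0 by (intro summable_suminf_not_top) auto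
      then have "summable (\<lambda>n. 1 / (2 * real (Suc n)))"
      proof (rule summable_comparison_test'[where N = 0])
        show "norm (1 / (2 * real (Suc n))) \<le> survival n" for n using survival_lower[OF z(2), of n] by simp
      qed
      then have "summable (\<lambda>n. 2 * (1 / (2 * real (Suc n))))" by (rule summable_mult)
      moreover have "2 * (1 / (2 * real (Suc n))) = real (Suc n) powr (- 1)" for n
        by (simp add: powr_minus_divide del: of_nat_Suc)
      ultimately have "summable (\<lambda>n. real (Suc n) powr (- 1))" by simp
      then show False
        using summable_Suc_iff[of "\<lambda>n. real n powr (- 1)"] summable_real_powr_iff[of "- 1"] by blast
    qed
    then have "\<top> = (\<integral>\<^sup>+ \<omega>. (\<Sum>n. indicator (D n) \<omega>) \<partial>M)"
      by (subst nn_integral_suminf) (auto simp: law_D)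
    also have "\<dots> \<le> (\<integral>\<^sup>+ \<omega>. enat_powr (T \<omega>) (1 + \<epsilon>) \<partial>M)"
    proof (rule nn_integral_mono_AE)
      show "AE \<omega> in M. (\<Sum>n. indicator (D n) \<omega>) \<le> enat_powr (T \<omega>) (1 + \<epsilon>)"
        using D_T T_finite
      proof eventually_elim
        case (elim \<omega>)
        then obtain t where t: "T \<omega> = enat t" by (cases "T \<omega>") auto
        have "(\<Sum>n. indicator (D n) \<omega> :: ennreal) = (\<Sum>n<t. indicator (D n) \<omega>)"
          using elim by (intro suminf_finite) (auto simp: t indicator_def)
        also have "\<dots> = (\<Sum>n<t. 1)" using elim by (intro sum.cong) (auto simp: t indicator_def)
        also have "\<dots> = ennreal (real t)" by (simp add: ennreal_of_nat_eq_real_of_nat)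
        also have "\<dots> \<le> ennreal (real t powr (1 + \<epsilon>))"
        proof (cases "t = 0")
          case False
          then show ?thesis using powr_mono[of 1 "1 + \<epsilon>" "real t"] \<epsilon> by (auto intro: ennreal_leI)
        qed simp
        finally show ?case using \<epsilon> by (simp add: t enat_powr_def)
      qed
    qed
    finally show ?thesis by (simp add: top_unique)
  qed
  ultimately show ?thesis unfolding T_def by blast
qed

end
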